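(* Let $g\colon S^3\to S^3$ be a fixed-point-free diffeomorphism with $g^3=\mathrm{id}$, and let $(M,f\times h)$ be a generalised sweepout. Then the sweepout contains triple points: there is a time $t\in\mathbb{R}$ for which $S_t\cap gS_t\cap g^2S_t\neq\emptyset$, where $S_t=f(h^{-1}(t))$.
   Context: A generalised sweepout is a triple $(M,f,h)$, written $(M,f\times h)$, where: $M$ is a closed orientable 3-manifold; $h\colon M\to\mathbb{R}$ is a Morse function such that for all but finitely many $t$ the level set $h^{-1}(t)$ is a collection of 2-spheres; $f\colon M\to S^3$ is a smooth map of degree one; and for every $t$ the restriction of $f$ to $h^{-1}(t)$ is an embedding. The map $\phi=f\times h\colon M\to S^3\times\mathbb{R}$ is a smooth embedding. *)

theory Defs
  imports "HOL-Analysis.Analysis" "HOL-Homology.Homology"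
begin

section \<open>Smooth maps between Euclidean spaces\<close>

text \<open>Intended for open \<open>U\<close>: all iterated directional derivatives of order at most \<open>k\<close> exist,
  are Frechet differentiable below order \<open>k\<close>, and are continuous.\<close>

primrec Ck_on :: "nat \<Rightarrow> 'a::euclidean_space set \<Rightarrow> ('a \<Rightarrow> 'b::euclidean_space) \<Rightarrow> bool" where
  "Ck_on 0 U f \<longleftrightarrow> continuous_on U f"
| "Ck_on (Suc k) U f \<longleftrightarrow>
     (\<forall>x\<in>U. f differentiable (at x)) \<and> (\<forall>v. Ck_on k U (\<lambda>x. frechet_derivative f (at x) v))"

definition smooth_on :: "'a::euclidean_space set \<Rightarrow> ('a \<Rightarrow> 'b::euclidean_space) \<Rightarrow> bool" where
  "smooth_on U f \<longleftrightarrow> (\<forall>k. Ck_on k U f)"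

text \<open>Smoothness on an arbitrary subset of Euclidean space: local existence of smooth extensions.\<close>

definition smooth_on_subset :: "'a::euclidean_space set \<Rightarrow> ('a \<Rightarrow> 'b::euclidean_space) \<Rightarrow> bool" where
  "smooth_on_subset S f \<longleftrightarrow>
     (\<forall>x\<in>S. \<exists>U F. open U \<and> x \<in> U \<and> smooth_on U F \<and> (\<forall>y\<in>S \<inter> U. F y = f y))"

definition diffeomorphism_on :: "'a::euclidean_space set \<Rightarrow> ('a \<Rightarrow> 'a) \<Rightarrow> bool" where
  "diffeomorphism_on S f \<longleftrightarrow>
     bij_betw f S S \<and> smooth_on_subset S f \<and> smooth_on_subset S (inv_into S f)"

section \<open>Smooth manifolds\<close>

text \<open>A chart is a pair of its domain and its coordinate map; the model space is \<^typ>\<open>'e\<close>.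
  Atlases are not required to be maximal.\<close>

type_synonym ('a, 'e) atlas = "('a set \<times> ('a \<Rightarrow> 'e)) set"

definition chart :: "'a topology \<Rightarrow> 'a set \<times> ('a \<Rightarrow> 'e::euclidean_space) \<Rightarrow> bool" where
  "chart X = (\<lambda>(U, \<phi>). openin X U \<and> open (\<phi> ` U) \<and>
     homeomorphic_map (subtopology X U) (top_of_set (\<phi> ` U)) \<phi>)"

definition smooth_atlas :: "'a topology \<Rightarrow> ('a, 'e::euclidean_space) atlas \<Rightarrow> bool" where
  "smooth_atlas X A \<longleftrightarrow>
     (\<forall>c\<in>A. chart X c) \<and> \<Union>(fst ` A) = topspace X \<and>
     (\<forall>(U, \<phi>)\<in>A. \<forall>(V, \<psi>)\<in>A. smooth_on (\<phi> ` (U \<inter> V)) (\<psi> \<circ> inv_into U \<phi>))"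

definition smooth_manifold :: "'a topology \<Rightarrow> ('a, 'e::euclidean_space) atlas \<Rightarrow> bool" where
  "smooth_manifold X A \<longleftrightarrow> Hausdorff_space X \<and> second_countable X \<and> smooth_atlas X A"

text \<open>Charts are modelled on the whole of \<^typ>\<open>'e\<close>, so a manifold has no boundary.\<close>

definition closed_manifold :: "'a topology \<Rightarrow> ('a, 'e::euclidean_space) atlas \<Rightarrow> bool" where
  "closed_manifold X A \<longleftrightarrow> smooth_manifold X A \<and> compact_space X"

definition smooth_map :: "('a, 'e::euclidean_space) atlas \<Rightarrow> ('a \<Rightarrow> 'b::euclidean_space) \<Rightarrow> bool" where
  "smooth_map A f \<longleftrightarrow> (\<forall>(U, \<phi>)\<in>A. smooth_on (\<phi> ` U) (f \<circ> inv_into U \<phi>))"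

definition chart_derivative ::
    "'a set \<times> ('a \<Rightarrow> 'e::euclidean_space) \<Rightarrow> ('a \<Rightarrow> 'b::euclidean_space) \<Rightarrow> 'a \<Rightarrow> 'e \<Rightarrow> 'b" where
  "chart_derivative = (\<lambda>(U, \<phi>) f p. frechet_derivative (f \<circ> inv_into U \<phi>) (at (\<phi> p)))"

definition chart_hessian ::
    "'a set \<times> ('a \<Rightarrow> 'e::euclidean_space) \<Rightarrow> ('a \<Rightarrow> real) \<Rightarrow> 'a \<Rightarrow> 'e \<Rightarrow> 'e \<Rightarrow> real" where
  "chart_hessian = (\<lambda>(U, \<phi>) h p v w.
     frechet_derivative
       (\<lambda>x. frechet_derivative (h \<circ> inv_into U \<phi>) (at x) v) (at (\<phi> p)) w)"

text \<open>Smooth, and nondegenerate at every critical point.\<close>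

definition Morse_function :: "('a, 'e::euclidean_space) atlas \<Rightarrow> ('a \<Rightarrow> real) \<Rightarrow> bool" where
  "Morse_function A h \<longleftrightarrow> smooth_map A h \<and>
     (\<forall>c\<in>A. \<forall>p\<in>fst c. (\<forall>v. chart_derivative c h p v = 0) \<longrightarrow>
        (\<forall>v. (\<forall>w. chart_hessian c h p v w = 0) \<longrightarrow> v = 0))"

text \<open>A smooth embedding of a manifold into a subset \<open>S\<close> of Euclidean space: a smooth immersion
  that is a homeomorphism onto its image.\<close>

definition smooth_embedding ::
    "'a topology \<Rightarrow> ('a, 'e::euclidean_space) atlas \<Rightarrow> 'b::euclidean_space set \<Rightarrow> ('a \<Rightarrow> 'b) \<Rightarrow> bool" where
  "smooth_embedding X A S f \<longleftrightarrow>
     f \<in> topspace X \<rightarrow> S \<and> smooth_map A f \<and> embedding_map X (top_of_set S) f \<and>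
     (\<forall>c\<in>A. \<forall>p\<in>fst c. inj (chart_derivative c f p))"

section \<open>Orientations and degree\<close>

text \<open>An orientation of an \<open>n\<close>-manifold \<open>X\<close> is a locally consistent choice of generators of the
  infinite cyclic groups $H_n(X, X - x)$.\<close>

definition is_generator :: "('g, 'm) monoid_scheme \<Rightarrow> 'g \<Rightarrow> bool" where
  "is_generator G a \<longleftrightarrow> a \<in> carrier G \<and> carrier (subgroup_generated G {a}) = carrier G"

definition orientation :: "nat \<Rightarrow> 'a topology \<Rightarrow> ('a \<Rightarrow> 'a chain set) \<Rightarrow> bool" where
  "orientation n X \<omega> \<longleftrightarrow>
     (\<forall>x\<in>topspace X.
        is_generator (relative_homology_group n X (topspace X - {x})) (\<omega> x)) \<and>
     (\<forall>x\<in>topspace X. \<exists>U. openin X U \<and> x \<in> U \<and>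
        (\<exists>a\<in>carrier (relative_homology_group n X (topspace X - U)). \<forall>y\<in>U.
           hom_induced n X (topspace X - U) X (topspace X - {y}) id a = \<omega> y))"

definition orientable :: "nat \<Rightarrow> 'a topology \<Rightarrow> bool" where
  "orientable n X \<longleftrightarrow> (\<exists>\<omega>. orientation n X \<omega>)"

definition fundamental_class ::
    "nat \<Rightarrow> 'a topology \<Rightarrow> ('a \<Rightarrow> 'a chain set) \<Rightarrow> 'a chain set \<Rightarrow> bool" where
  "fundamental_class n X \<omega> a \<longleftrightarrow>
     a \<in> carrier (homology_group n X) \<and>
     (\<forall>x\<in>topspace X. hom_induced n X {} X (topspace X - {x}) id a = \<omega> x)"

text \<open>For closed manifolds \<open>X\<close> and \<open>Y\<close> with orientations \<open>\<omega>\<close> and \<open>\<eta>\<close>: $f_*[X] = d\,[Y]$.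
  The group operation of homology is written multiplicatively.\<close>

definition has_degree ::
    "nat \<Rightarrow> 'a topology \<Rightarrow> ('a \<Rightarrow> 'a chain set) \<Rightarrow> 'b topology \<Rightarrow> ('b \<Rightarrow> 'b chain set) \<Rightarrow>
     ('a \<Rightarrow> 'b) \<Rightarrow> int \<Rightarrow> bool" where
  "has_degree n X \<omega> Y \<eta> f d \<longleftrightarrow>
     (\<exists>a b. fundamental_class n X \<omega> a \<and> fundamental_class n Y \<eta> b \<and>
        hom_induced n X {} Y {} f a = b [^]\<^bsub>homology_group n Y\<^esub> d)"

section \<open>Generalised sweepouts\<close>

abbreviation S3 :: "(real^4) set" where
  "S3 \<equiv> sphere 0 1"

abbreviation S2 :: "(real^3) set" where
  "S2 \<equiv> sphere 0 1"

definition level_set :: "'a topology \<Rightarrow> ('a \<Rightarrow> real) \<Rightarrow> real \<Rightarrow> 'a set" where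
  "level_set X h t = {p \<in> topspace X. h p = t}"

text \<open>A (possibly empty) disjoint union of finitely many 2-spheres.  As there are finitely many
  components, each of them is open, so the space has the disjoint union topology.\<close>

definition collection_of_2_spheres :: "'a topology \<Rightarrow> bool" where
  "collection_of_2_spheres X \<longleftrightarrow>
     finite (connected_components_of X) \<and>
     (\<forall>C\<in>connected_components_of X. subtopology X C homeomorphic_space top_of_set S2)"

text \<open>\<open>M\<close> need not be connected.  The orientations with respect to which \<open>f\<close> has degree one are
  part of the data that is asserted to exist.  On level sets, which are singular at critical values
  of \<open>h\<close>, the embedding condition is the topological one; at regular points of \<open>h\<close>
  the injectivity of the derivative of \<open>f\<close> along the level set is a consequence of \<open>f \<times> h\<close>
  being an immersion.\<close>

definition generalised_sweepout ::
    "'a topology \<Rightarrow> ('a, real^3) atlas \<Rightarrow> ('a \<Rightarrow> real^4) \<Rightarrow> ('a \<Rightarrow> real) \<Rightarrow> bool" where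
  "generalised_sweepout M A f h \<longleftrightarrow>
     closed_manifold M A \<and> orientable 3 M \<and>
     Morse_function A h \<and>
     finite {t. \<not> collection_of_2_spheres (subtopology M (level_set M h t))} \<and>
     f \<in> topspace M \<rightarrow> S3 \<and> smooth_map A f \<and>
     (\<exists>\<omega> \<eta>. orientation 3 M \<omega> \<and> orientation 3 (top_of_set S3) \<eta> \<and>
        has_degree 3 M \<omega> (top_of_set S3) \<eta> f 1) \<and>
     (\<forall>t. embedding_map (subtopology M (level_set M h t)) (top_of_set S3) f) \<and>
     smooth_embedding M A (S3 \<times> UNIV) (\<lambda>p. (f p, h p))"

definition sweepout_surface ::
    "'a topology \<Rightarrow> ('a \<Rightarrow> real^4) \<Rightarrow> ('a \<Rightarrow> real) \<Rightarrow> real \<Rightarrow> (real^4) set" where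
  "sweepout_surface M f h t = f ` level_set M h t"

end

theory Submission
  imports Defs
begin

text \<open>The key is to look for the triple point in $S^3 \times \mathbb{R}$ rather than in a single level set.
Identify $S^3 \times \mathbb{R}$ with $\mathbb{R}^4 \setminus 0$ by $(x, t) \mapsto e^t x$, and let
\<open>K\<close> be the compact image of \<open>M\<close> under \<open>p \<mapsto> exp (h p) *\<^sub>R f p\<close>.  If \<open>x\<close> is a point of the unit
sphere such that \<open>r *\<^sub>R x\<close>, \<open>r *\<^sub>R g x\<close> and \<open>r *\<^sub>R g (g x)\<close> all lie in \<open>K\<close>, then
\<open>g (g x)\<close> is a triple point at time \<open>ln r\<close>, and all triple points arise in this way.

Since \<open>f\<close> has degree one, \<open>K\<close> separates \<open>0\<close> from infinity.  Indeed, \<open>f\<close> is the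
composition of \<open>M \<rightarrow> K\<close> with the radial projection of \<open>K\<close> to the sphere.  By Borsuk's criterion this
projection would be null-homotopic if \<open>0\<close> were not in a bounded component of the complement of \<open>K\<close>;
then \<open>f\<close> would be null-homotopic and could not have degree one
(\<open>degree_one_imp_essential\<close>, \<open>essential_map_separates_origin\<close>).

Hence there is a continuous function \<open>F\<close>, negative at \<open>0\<close> and positive near infinity, that vanishes
only on \<open>K\<close>.  If there were no triple point, the triple of the values of \<open>F\<close> at \<open>t *\<^sub>R x\<close>,
\<open>t *\<^sub>R g x\<close> and \<open>t *\<^sub>R g (g x)\<close> would never be zero.  Replacing \<open>x\<close> by \<open>g x\<close> permutes these values
cyclically.  In coordinates $\mathbb{R}^3 = \mathbb{R} \oplus \mathbb{C}$ adapted to the cyclic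
permutation, in which it is the identity on the first summand and multiplication by a primitive cube
root of unity \<open>\<omega>\<close> on the second, the triple becomes \<open>(s, w)\<close>.  The nonzero vector \<open>(s, w)\<close> determines
the positive eigenline of the Hermitian matrix with rows \<open>(s, w)\<close> and \<open>(cnj w, - s)\<close>, that is, a
line in $\mathbb{C}^2$; up to scaling this identifies $S^2$ with the complex projective line, and
\<open>g\<close> acts on the lines by \<open>diag(\<omega>, 1)\<close>.  At \<open>t = 0\<close> the line is spanned by \<open>(0, 1)\<close>, an invariant
vector.  Orthogonal projection from each line to the line at a slightly later time carries this
vector along and commutes with the symmetry (\<open>equivariant_line_transport\<close>).  For large \<open>t\<close> all values
of \<open>F\<close> are positive, so \<open>s > 0\<close> and the first coordinate of a nonzero vector of the line cannot
vanish.  The result is a continuous map \<open>a\<close> from the sphere to the punctured complex plane with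
\<open>a (g x) = \<omega> * a x\<close>.  Such a map does not exist: as the sphere is simply connected, \<open>a\<close> has a
continuous logarithm, which changes under \<open>g\<close> by a constant in $2\pi i (1/3 + \mathbb{Z})$, while
\<open>g\<close> applied three times is the identity (\<open>no_cyclic_equivariant_map_to_punctured_plane\<close>).\<close>

section \<open>Maps of degree one are essential\<close>

text \<open>The definition of an orientation alone does not exclude that the fundamental class of the sphere is
trivial; this nontriviality does.  The complement of a point is contractible, so the relative group
is the reduced homology of the sphere.\<close>

lemma nontrivial_relative_homology_punctured_sphere:
  fixes x :: "'n::euclidean_space"
  assumes n: "DIM('n) = Suc n" "n \<noteq> 0" and x: "x \<in> sphere 0 1"
  shows "\<not> trivial_group (relative_homology_group (int n) (top_of_set (sphere 0 1)) (sphere 0 1 - {x}))"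
proof
  let ?S = "sphere (0::'n) 1"
  assume triv: "trivial_group (relative_homology_group (int n) (top_of_set ?S) (?S - {x}))"
  have "?S - {x} homeomorphic {y::'n. x \<bullet> y = 0}"
    using x by (intro homeomorphic_punctured_sphere_hyperplane) auto
  moreover have "contractible {y::'n. x \<bullet> y = 0}"
    by (intro convex_imp_contractible convex_hyperplane)
  ultimately have "contractible (?S - {x})"
    using homeomorphic_contractible_eq by blast
  moreover have "- x \<noteq> x"
    using x scaleR_2 [of x] by (auto simp: neg_eq_iff_add_eq_0)
  then have "- x \<in> topspace (top_of_set ?S) \<inter> (?S - {x})"
    using x by auto
  then have "topspace (top_of_set ?S) \<inter> (?S - {x}) \<noteq> {}"
    by blast
  ultimately have "reduced_homology_group (int n) (top_of_set ?S)
      \<cong> relative_homology_group (int n) (top_of_set ?S) (?S - {x})"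
    by (intro isomorphic_reduced_homology_by_contractible)
      (auto simp: subtopology_subtopology inf.absorb2)
  then have "trivial_group (reduced_homology_group (int n) (top_of_set ?S))"
    using triv isomorphic_group_triviality by (metis group_reduced_homology_group group_relative_homology_group)
  moreover obtain f :: "(nat \<Rightarrow> real) \<Rightarrow> 'n" and f' where "homeomorphic_maps (nsphere n) (top_of_set ?S) f f'"
    by (rule homeomorphic_maps_nsphere_euclidean_sphere
        [OF independent_Basis [where 'a = 'n] orthogonal_Basis refl _ norm_Basis]) (auto simp: n)
  then have "reduced_homology_group (int n) (nsphere n) \<cong> reduced_homology_group (int n) (top_of_set ?S)"
    by (meson homeomorphic_maps_imp_homeomorphic_space homeomorphic_space_imp_isomorphic_reduced_homology_groups)
  ultimately have "trivial_group (reduced_homology_group (int n) (nsphere n))"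
    by (meson group_reduced_homology_group isomorphic_group_triviality)
  then show False
    by (simp add: trivial_reduced_homology_group_nsphere)
qed

text \<open>A constant map factors through a point, which has no homology in nonzero degrees.\<close>

lemma hom_induced_nullhomotopic:
  assumes h: "homotopic_with (\<lambda>_. True) X Y f (\<lambda>_. c)" and p: "p \<noteq> 0"
    and a: "a \<in> carrier (homology_group p X)"
  shows "hom_induced p X {} Y {} f a = \<one>\<^bsub>homology_group p Y\<^esub>"
proof (cases "topspace X = {}")
  case True
  then have "a = \<one>\<^bsub>homology_group p X\<^esub>"
    using a trivial_homology_group_empty [of X p] by (auto simp: trivial_group_def)
  then show ?thesis
    using hom_induced_empty_hom [of p X Y f] by (simp add: hom_one)
next
  case False
  let ?P = "subtopology Y {c}"
  have c: "c \<in> topspace Y"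
    using homotopic_with_imp_continuous_maps [OF h] False by auto
  have k: "continuous_map X ?P (\<lambda>_. c)" and i: "continuous_map ?P Y id"
    using c by (auto simp: continuous_map_in_subtopology continuous_map_from_subtopology)
  have "trivial_group (homology_group p ?P)"
    using c p by (intro homology_dimension_axiom [of _ c]) auto
  moreover have "hom_induced p X {} ?P {} (\<lambda>_. c) a \<in> carrier (homology_group p ?P)"
    by (rule hom_induced_carrier)
  ultimately have 1: "hom_induced p X {} ?P {} (\<lambda>_. c) a = \<one>\<^bsub>homology_group p ?P\<^esub>"
    by (auto simp: trivial_group_def)
  have "hom_induced p X {} Y {} f a = hom_induced p X {} Y {} (id \<circ> (\<lambda>_. c)) a"
    using homology_homotopy_empty [OF h] by (simp add: o_def)
  also have "\<dots> = hom_induced p ?P {} Y {} id (hom_induced p X {} ?P {} (\<lambda>_. c) a)"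
    using hom_induced_compose_empty [OF k i, of p] by simp
  also have "\<dots> = \<one>\<^bsub>homology_group p Y\<^esub>"
    unfolding 1 using hom_induced_empty_hom [of p ?P Y id] by (simp add: hom_one)
  finally show ?thesis .
qed

text \<open>A null-homotopic map sends the fundamental class to the identity of the homology group.  If that were
the fundamental class of the sphere, its local restrictions, which generate nontrivial groups, would
be trivial.\<close>

lemma degree_one_imp_essential:
  fixes f :: "'a \<Rightarrow> 'n::euclidean_space"
  assumes n: "DIM('n) = Suc n" "n \<noteq> 0"
    and or: "orientation n (top_of_set (sphere 0 1)) \<eta>"
    and deg: "has_degree n X \<omega> (top_of_set (sphere 0 1)) \<eta> f 1"
  shows "\<not> homotopic_with (\<lambda>_. True) X (top_of_set (sphere 0 1)) f (\<lambda>_. c)"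
proof
  let ?S = "sphere (0::'n) 1"
  let ?Y = "top_of_set ?S"
  assume null: "homotopic_with (\<lambda>_. True) X ?Y f (\<lambda>_. c)"
  obtain a b where a: "a \<in> carrier (homology_group n X)"
    and b: "fundamental_class n ?Y \<eta> b"
    and ab: "hom_induced n X {} ?Y {} f a = b [^]\<^bsub>homology_group n ?Y\<^esub> (1::int)"
    using deg unfolding has_degree_def fundamental_class_def by blast
  interpret Y: group "homology_group n ?Y" by simp
  have bY: "b \<in> carrier (homology_group n ?Y)"
    using b by (simp add: fundamental_class_def)
  have b1: "b = \<one>\<^bsub>homology_group n ?Y\<^esub>"
    using hom_induced_nullhomotopic [OF null _ a] ab n(2) Y.int_pow_1 [OF bY] by simp
  obtain x where x: "x \<in> ?S"
    using vector_choose_size [of 1] by (auto simp: dist_norm)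
  let ?R = "relative_homology_group n ?Y (?S - {x})"
  interpret R: group ?R by simp
  have "\<eta> x = hom_induced n ?Y {} ?Y (?S - {x}) id b"
    using b x by (simp add: fundamental_class_def)
  also have "\<dots> = \<one>\<^bsub>?R\<^esub>"
    unfolding b1 by (rule hom_one [OF hom_induced_hom]) auto
  finally have "\<eta> x = \<one>\<^bsub>?R\<^esub>" .
  moreover have "is_generator ?R (\<eta> x)"
    using or x by (simp add: orientation_def)
  moreover have "trivial_group (subgroup_generated ?R {\<one>\<^bsub>?R\<^esub>})"
    by (simp add: R.trivial_group_subgroup_generated)
  ultimately have "trivial_group ?R"
    unfolding is_generator_def trivial_group_def by (simp only: R.is_group simp_thms) simp
  then show False
    using nontrivial_relative_homology_punctured_sphere [OF n x] by blast
qed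

section \<open>Separation of the origin from infinity\<close>

text \<open>Radial projection removes the factor \<open>exp (h p)\<close> and so composes with \<open>X \<rightarrow> K\<close> to \<open>f\<close>.  Hence it
cannot be null-homotopic on \<open>K\<close>, and Borsuk's criterion turns this into a separation property.\<close>

lemma essential_map_separates_origin:
  fixes f :: "'a \<Rightarrow> 'n::euclidean_space"
  assumes X: "compact_space X" and f: "continuous_map X (top_of_set (sphere 0 1)) f"
    and h: "continuous_map X euclideanreal h"
    and ess: "\<And>c. \<not> homotopic_with (\<lambda>_. True) X (top_of_set (sphere 0 1)) f (\<lambda>_. c)"
  defines "K \<equiv> (\<lambda>p. exp (h p) *\<^sub>R f p) ` topspace X"
  shows "compact K" "0 \<notin> K" "bounded (connected_component_set (- K) 0)"
proof -
  have norm_f: "norm (f p) = 1" if "p \<in> topspace X" for p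
    using f that by (auto simp: continuous_map_in_subtopology)
  have "continuous_map X euclidean f"
    using f by (simp add: continuous_map_in_subtopology)
  then have cont: "continuous_map X euclidean (\<lambda>p. exp (h p) *\<^sub>R f p)"
    using h by (auto simp: continuous_map_atin intro!: tendsto_intros)
  show K: "compact K"
    using image_compactin [OF _ cont, of "topspace X"] X by (simp add: K_def compact_space_def)
  show 0: "0 \<notin> K"
    using norm_f by (force simp: K_def)
  let ?\<rho> = "\<lambda>y::'n. inverse (norm (y - 0)) *\<^sub>R (y - 0)"
  show "bounded (connected_component_set (- K) 0)"
  proof (rule ccontr)
    assume "\<not> ?thesis"
    then obtain c where c: "homotopic_with_canon (\<lambda>_. True) K (sphere 0 1) ?\<rho> (\<lambda>_. c)"
      using Borsuk_map_essential_bounded_component [OF K 0] by blast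
    have "continuous_map X (top_of_set K) (\<lambda>p. exp (h p) *\<^sub>R f p)"
      using cont by (auto simp: continuous_map_in_subtopology K_def)
    from homotopic_with_compose_continuous_map_right [OF c this, of "\<lambda>_. True"]
    have "homotopic_with (\<lambda>_. True) X (top_of_set (sphere 0 1)) f (\<lambda>_. c)"
      by (rule homotopic_with_eq) (auto simp: norm_f)
    with ess show False by blast
  qed
qed

text \<open>The function is the distance to the component of \<open>a\<close> minus the distance to the rest of the
complement.  Only its signs off \<open>K\<close> matter: on \<open>K\<close> itself it may take any value.\<close>

lemma separating_function:
  fixes K :: "'n::euclidean_space set"
  assumes K: "compact K" and a: "a \<notin> K" and bdd: "bounded (connected_component_set (- K) a)"
  obtains F :: "'n \<Rightarrow> real" and R where "continuous_on UNIV F" "\<And>y. F y = 0 \<Longrightarrow> y \<in> K"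
    "F a < 0" "R > 0" "\<And>y. norm y \<ge> R \<Longrightarrow> F y > 0"
proof -
  define U where "U = connected_component_set (- K) a"
  define V where "V = - K - U"
  have "open (- K)"
    using K by (simp add: compact_imp_closed open_Compl)
  then have U: "open U" and V: "open V"
    using openin_diff [OF openin_subtopology_self closedin_connected_component, of "- K" a]
    by (auto simp: U_def V_def open_connected_component openin_open_eq)
  have aU: "a \<in> U"
    using a by (simp add: U_def)
  have "bounded (K \<union> U)"
    using bdd K by (simp add: U_def compact_imp_bounded)
  then obtain R where R: "R > 0" "\<And>y. y \<in> K \<union> U \<Longrightarrow> norm y < R"
    by (auto simp: bounded_pos_less)
  have RV: "y \<in> V" if "norm y \<ge> R" for y
    using R(2) [of y] that by (auto simp: V_def)
  obtain b :: 'n where "norm b = R"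
    using vector_choose_size [of R] R(1) by auto
  then have bV: "b \<in> V"
    using RV by simp
  define F where "F y = infdist y U - infdist y V" for y
  have neg: "F y < 0" if "y \<in> U" for y
  proof -
    have "y \<notin> closure V"
      using that U open_Int_closure_eq_empty [of U V] by (auto simp: V_def)
    then have "infdist y V \<noteq> 0" using bV in_closure_iff_infdist_zero by blast
    then show ?thesis
      using that infdist_nonneg [of y V] by (simp add: F_def)
  qed
  have pos: "F y > 0" if "y \<in> V" for y
  proof -
    have "y \<notin> closure U"
      using that V open_Int_closure_eq_empty [of V U] by (auto simp: V_def)
    then have "infdist y U \<noteq> 0" using aU in_closure_iff_infdist_zero by blast
    then show ?thesis
      using that infdist_nonneg [of y U] by (simp add: F_def)
  qed
  show thesis
  proof
    show "continuous_on UNIV F"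
      unfolding F_def by (intro continuous_intros)
    show "y \<in> K" if "F y = 0" for y
      using that neg [of y] pos [of y] by (auto simp: V_def)
    show "F a < 0" "R > 0" "\<And>y. norm y \<ge> R \<Longrightarrow> F y > 0"
      using neg aU R(1) RV pos by auto
  qed
qed

section \<open>Equivariant maps to the punctured plane\<close>

text \<open>A statement of Borsuk-Ulam type.  A logarithm of \<open>a\<close> increases along each step of a \<open>g\<close>-orbit by the
same number $2 \pi i (1/n + k)$, so after \<open>n\<close> steps it cannot return to its initial value.\<close>

lemma no_cyclic_equivariant_map_to_punctured_plane:
  fixes a :: "'a::real_normed_vector \<Rightarrow> complex"
  assumes S: "simply_connected S" "locally path_connected S" "S \<noteq> {}"
    and g: "continuous_on S g" "g ` S \<subseteq> S" "\<And>x. x \<in> S \<Longrightarrow> (g ^^ n) x = x" and n: "n \<ge> 2"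
    and a: "continuous_on S a" "\<And>x. x \<in> S \<Longrightarrow> a x \<noteq> 0"
    and eq: "\<And>x. x \<in> S \<Longrightarrow> a (g x) = cis (2 * pi / n) * a x"
  shows False
proof -
  obtain l where l: "continuous_on S l" and al: "\<And>x. x \<in> S \<Longrightarrow> a x = exp (l x)"
    using continuous_logarithm_on_simply_connected [OF a(1) S(1,2) a(2)] by blast
  \<comment> \<open>the change of the logarithm in full turns, minus the \<open>1 / n\<close> expected of it; an integer\<close>
  define d where "d x = (l (g x) - l x) / (2 * pi * \<i>) - 1 / n" for x
  have dint: "d x \<in> \<int>" if x: "x \<in> S" for x
  proof -
    have "exp (l (g x)) = exp (\<i> * (2 * pi / n) + l x)"
      using x g(2) eq [OF x] by (simp add: al image_subset_iff cis_conv_exp exp_add)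
    then obtain k :: int where "l (g x) = \<i> * (2 * pi / n) + l x + 2 * of_int k * pi * \<i>"
      unfolding exp_eq by auto
    then have "d x = of_int k"
      using n by (simp add: d_def field_simps)
    then show ?thesis by simp
  qed
  have cd: "continuous_on S d"
    unfolding d_def by (intro continuous_intros continuous_on_compose2 [OF l g(1) g(2)] l) auto
  have conn: "connected S"
    using S(1) simply_connected_imp_connected by blast
  have "\<exists>k::int. \<forall>x\<in>S. d x = of_int k"
  proof -
    have "d constant_on S"
    proof (rule continuous_discrete_range_constant [OF conn cd])
      fix x assume x: "x \<in> S"
      show "\<exists>e>0. \<forall>y. y \<in> S \<and> d y \<noteq> d x \<longrightarrow> e \<le> norm (d y - d x)"
      proof (intro exI [of _ 1] conjI allI impI)
        fix y assume y: "y \<in> S \<and> d y \<noteq> d x"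
        obtain i j :: int where "d x = of_int i" "d y = of_int j"
          using dint x y by (metis Ints_cases)
        with y show "1 \<le> norm (d y - d x)"
          by (simp flip: of_int_diff del: of_int_diff) linarith
      qed simp
    qed
    then obtain k where k: "\<And>x. x \<in> S \<Longrightarrow> d x = k" unfolding constant_on_def by blast
    obtain x where "x \<in> S" using S(3) by blast
    then have "k \<in> \<int>" using dint k by metis
    with k show ?thesis by (metis Ints_cases)
  qed
  then obtain k :: int where k: "\<And>x. x \<in> S \<Longrightarrow> d x = of_int k" by blast
  have step: "l (g x) = l x + 2 * pi * \<i> * (1 / n + of_int k)" if "x \<in> S" for x
    using k [OF that] by (simp add: d_def field_simps)
  have "(g ^^ m) x \<in> S \<and> l ((g ^^ m) x) = l x + of_nat m * (2 * pi * \<i> * (1 / n + of_int k))"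
    if x: "x \<in> S" for m x
  proof (induction m)
    case (Suc m)
    then show ?case
      using step [of "(g ^^ m) x"] g(2) by (auto simp: algebra_simps add_divide_distrib)
  qed (use x in simp)
  moreover obtain x where x: "x \<in> S"
    using S(3) by blast
  ultimately have "of_nat n * (2 * pi * \<i> * (1 / n + of_int k)) = 0"
    using g(3) [OF x] by (metis add_cancel_left_right)
  then have "(1 / of_nat n + of_int k :: complex) = 0"
    using n by auto
  then have "1 + of_nat n * (of_int k :: complex) = 0"
    using n by (simp add: field_simps)
  then have "of_int (1 + int n * k) = (of_int 0 :: complex)"
    by simp
  then have "1 + int n * k = 0"
    by (simp only: of_int_eq_iff)
  then have "int n dvd 1"
    by (metis dvd_def add_eq_0_iff2 dvd_minus_iff mult_minus_right)
  then show False
    using n by auto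
qed

text \<open>Encode \<open>(s, w)\<close> by the Hermitian matrix \<open>H\<close> with rows \<open>(s, w)\<close> and \<open>(cnj w, - s)\<close>, whose square is
the scalar \<open>r\<^sup>2\<close>, where \<open>r\<close> is the norm of \<open>(s, w)\<close>.  Thus \<open>H + r\<close> is, up to the factor \<open>2 * r\<close>, the
orthogonal projection to the eigenline for \<open>r\<close>.  Projecting a vector of the eigenline at time \<open>t\<close> to
the eigenline at time \<open>t'\<close> gives zero only if \<open>(s, w)\<close> points in opposite directions at the two times;
this does not happen when \<open>t'\<close> is close to \<open>t\<close>, uniformly in \<open>x\<close> by compactness.  The matrix at
\<open>g x\<close> is the conjugate of that at \<open>x\<close> by \<open>diag(\<zeta>, 1)\<close>, hence the projections preserve
equivariance exactly.  Initially the eigenline is spanned by \<open>(0, 1)\<close>; at the end, where \<open>s > 0\<close>, it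
contains no nonzero vector with first coordinate zero, and that coordinate is the required map.\<close>

lemma equivariant_line_transport:
  fixes s :: "'a::metric_space \<times> real \<Rightarrow> real" and w :: "'a \<times> real \<Rightarrow> complex"
  assumes S: "compact S"
    and s: "continuous_on (S \<times> {0..1}) s" and w: "continuous_on (S \<times> {0..1}) w"
    and nz: "\<And>x t. x \<in> S \<Longrightarrow> t \<in> {0..1} \<Longrightarrow> s (x, t) \<noteq> 0 \<or> w (x, t) \<noteq> 0"
    and sg: "\<And>x t. x \<in> S \<Longrightarrow> t \<in> {0..1} \<Longrightarrow> s (g x, t) = s (x, t)"
    and wg: "\<And>x t. x \<in> S \<Longrightarrow> t \<in> {0..1} \<Longrightarrow> w (g x, t) = \<zeta> * w (x, t)"
    and \<zeta>: "norm \<zeta> = 1"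
    and bot: "\<And>x. x \<in> S \<Longrightarrow> s (x, 0) < 0 \<and> w (x, 0) = 0"
    and top: "\<And>x. x \<in> S \<Longrightarrow> s (x, 1) > 0"
  obtains a where "continuous_on S a" "\<And>x. x \<in> S \<Longrightarrow> a x \<noteq> 0" "\<And>x. x \<in> S \<Longrightarrow> a (g x) = \<zeta> * a x"
proof -
  define r where "r p = norm (s p, w p)" for p
  have r2: "(complex_of_real (r p))\<^sup>2 = (of_real (s p))\<^sup>2 + w p * cnj (w p)" for p
    by (simp add: r_def norm_prod_def flip: complex_norm_square of_real_power of_real_add)
  have rg: "r (g x, t) = r (x, t)" if "x \<in> S" "t \<in> {0..1}" for x t
    using that by (simp add: r_def norm_prod_def sg wg norm_mult \<zeta>)
  have contr: "continuous_on (S \<times> {0..1}) r"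
    unfolding r_def by (intro continuous_intros s w)
  have \<zeta>\<zeta>: "cnj \<zeta> * \<zeta> = 1"
    using \<zeta> complex_norm_square [of \<zeta>] by (simp add: mult.commute)
  have "\<exists>m>0. \<forall>p \<in> S \<times> {0..1}. m \<le> r p"
  proof (cases "S = {}")
    case False
    then obtain p where "p \<in> S \<times> {0..1}" "\<forall>q \<in> S \<times> {0..1}. r p \<le> r q"
      using continuous_attains_inf [OF _ _ contr] S by (auto intro: compact_Times)
    moreover have "r p > 0" using nz[of "fst p" "snd p"] \<open>p \<in> _\<close> by (auto simp: r_def prod_eq_iff)
    ultimately show ?thesis by blast
  qed (auto intro: exI [of _ 1])
  then obtain m where m: "m > 0" "\<And>p. p \<in> S \<times> {0..1} \<Longrightarrow> m \<le> r p" by blast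
  have "uniformly_continuous_on (S \<times> {0..1}) (\<lambda>p. (s p, w p))"
    by (intro compact_uniformly_continuous compact_Times S compact_Icc continuous_intros s w)
  then obtain \<delta> where \<delta>: "\<delta> > 0" and close: "\<And>p q. p \<in> S \<times> {0..1} \<Longrightarrow> q \<in> S \<times> {0..1} \<Longrightarrow> dist p q < \<delta>
      \<Longrightarrow> dist (s p, w p) (s q, w q) < m"
    using m(1) unfolding uniformly_continuous_on_def by (metis dist_commute)
  \<comment> \<open>\<open>(a, b)\<close> is a nonzero vector in the eigenline of \<open>H\<close> for \<open>r\<close>\<close>
  define line where "line p a b \<longleftrightarrow> (a \<noteq> 0 \<or> b \<noteq> 0) \<and> of_real (s p) * a + w p * b = of_real (r p) * a
      \<and> cnj (w p) * a - of_real (s p) * b = of_real (r p) * b" for p a b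
  define P where "P t \<longleftrightarrow> (\<exists>a b. continuous_on S a \<and> continuous_on S b \<and> (\<forall>x\<in>S. line (x, t) (a x) (b x)
      \<and> a (g x) = \<zeta> * a x \<and> b (g x) = b x))" for t
  \<comment> \<open>the new vector is \<open>H q + r q\<close> applied to \<open>(a, b)\<close>\<close>
  have move: "line q ((s q + r q) * a + w q * b) (cnj (w q) * a + (r q - s q) * b)"
    if p: "p \<in> S \<times> {0..1}" and q: "q \<in> S \<times> {0..1}" and pq: "dist p q < \<delta>" and l: "line p a b" for p q and a b :: complex
  proof -
    have "(s q + r q) * a + w q * b \<noteq> 0 \<or> cnj (w q) * a + (r q - s q) * b \<noteq> 0"
    proof (rule ccontr)
      assume "\<not> ?thesis"
      \<comment> \<open>then \<open>H q\<close> multiplies \<open>(a, b)\<close> by \<open>- r q\<close>, so \<open>H p - H q\<close> multiplies it by \<open>r p + r q \<ge> 2 * m\<close>\<close>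
      then have 1: "(r p + r q) * a = (s p - s q) * a + (w p - w q) * b"
        and 2: "(r p + r q) * b = cnj (w p - w q) * a - (s p - s q) * b"
        using l unfolding line_def by (auto simp: algebra_simps add_eq_0_iff)
      have "\<bar>s p - s q\<bar> < m" "norm (w p - w q) < m"
        using close [OF p q pq] dist_fst_le [of "(s p, w p)" "(s q, w q)"] dist_snd_le [of "(s p, w p)" "(s q, w q)"]
        by (auto simp: dist_norm)
      moreover have "(r p + r q) * (norm a + norm b) \<le> (\<bar>s p - s q\<bar> + norm (w p - w q)) * (norm a + norm b)"
      proof -
        have rr: "norm (complex_of_real (r p + r q)) = r p + r q"
          unfolding norm_of_real by (simp add: r_def)
        have "(r p + r q) * norm a \<le> \<bar>s p - s q\<bar> * norm a + norm (w p - w q) * norm b"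
          using norm_triangle_ineq [of "(s p - s q) * a" "(w p - w q) * b"] arg_cong [OF 1, of norm] rr
          by (simp add: norm_mult flip: of_real_diff of_real_add)
        moreover have "(r p + r q) * norm b \<le> norm (w p - w q) * norm a + \<bar>s p - s q\<bar> * norm b"
          using norm_triangle_ineq4 [of "cnj (w p - w q) * a" "(s p - s q) * b"] arg_cong [OF 2, of norm] rr
          by (simp add: norm_mult flip: of_real_diff of_real_add complex_cnj_diff)
        ultimately show ?thesis by (simp add: algebra_simps)
      qed
      moreover have "norm a + norm b > 0"
        using l unfolding line_def by (auto simp: add_pos_nonneg add_nonneg_pos)
      ultimately show False
        using m(2) [OF p] m(2) [OF q] by auto
    qed
    then show ?thesis
      using r2 [of q] unfolding line_def by (simp add: algebra_simps power2_eq_square)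
  qed
  have step: "P t'" if t: "t \<in> {0..1}" and t': "t' \<in> {0..1}" and tt: "dist t t' < \<delta>" and Pt: "P t" for t t'
  proof -
    obtain a b where a: "continuous_on S a" and b: "continuous_on S b"
      and ab: "\<And>x. x \<in> S \<Longrightarrow> line (x, t) (a x) (b x)"
      and ag: "\<And>x. x \<in> S \<Longrightarrow> a (g x) = \<zeta> * a x" and bg: "\<And>x. x \<in> S \<Longrightarrow> b (g x) = b x"
      using Pt unfolding P_def by blast
    define q where "q x = (x, t')" for x :: 'a
    have q: "continuous_on S q" "q ` S \<subseteq> S \<times> {0..1}"
      using t' by (auto simp: q_def intro!: continuous_intros)
    note cont = continuous_on_compose2 [OF s q] continuous_on_compose2 [OF w q] continuous_on_compose2 [OF contr q]
    show ?thesis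
      unfolding P_def
    proof (intro exI conjI ballI)
      show "continuous_on S (\<lambda>x. (s (q x) + r (q x)) * a x + w (q x) * b x)"
        "continuous_on S (\<lambda>x. cnj (w (q x)) * a x + (r (q x) - s (q x)) * b x)"
        by (intro continuous_intros cont a b)+
      fix x assume x: "x \<in> S"
      show "line (x, t') ((s (q x) + r (q x)) * a x + w (q x) * b x)
          (cnj (w (q x)) * a x + (r (q x) - s (q x)) * b x)"
        using move [OF _ _ _ ab [OF x], of "(x, t')"] x t t' tt by (simp add: q_def dist_Pair_Pair)
      show "(s (q (g x)) + r (q (g x))) * a (g x) + w (q (g x)) * b (g x)
          = \<zeta> * ((s (q x) + r (q x)) * a x + w (q x) * b x)"
        using x t' by (simp add: q_def sg wg rg ag bg algebra_simps)
      have "cnj (\<zeta> * w (x, t')) * (\<zeta> * a x) = cnj (w (x, t')) * a x"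
        using \<zeta>\<zeta> by (simp add: algebra_simps)
      then show "cnj (w (q (g x))) * a (g x) + (r (q (g x)) - s (q (g x))) * b (g x)
          = cnj (w (q x)) * a x + (r (q x) - s (q x)) * b x"
        using x t' by (simp add: q_def sg wg rg ag bg del: complex_cnj_mult)
    qed
  qed
  have "P 0"
    unfolding P_def
  proof (intro exI conjI ballI)
    show "continuous_on S (\<lambda>_. 0::complex)" "continuous_on S (\<lambda>_. 1::complex)" by auto
    fix x assume "x \<in> S"
    then show "line (x, 0) 0 1"
      using bot [of x] by (simp add: line_def r_def norm_prod_def)
  qed auto
  have "P 1"
  proof (rule connected_induction_simple [where S = "{0..1::real}" and P = P and a = 0])
    fix t :: real assume t: "t \<in> {0..1}"
    show "\<exists>T. openin (top_of_set {0..1}) T \<and> t \<in> T \<and> (\<forall>x\<in>T. \<forall>y\<in>T. P x \<longrightarrow> P y)"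
    proof (intro exI conjI ballI impI)
      show "openin (top_of_set {0..1}) ({0..1} \<inter> ball t (\<delta> / 2))" by (simp add: openin_open_Int)
      fix x y assume "x \<in> {0..1} \<inter> ball t (\<delta> / 2)" "y \<in> {0..1} \<inter> ball t (\<delta> / 2)" "P x"
      then show "P y" using step [of x y] dist_triangle_half_r [of t x \<delta> y] by auto
    qed (use t \<delta> in auto)
  qed (use \<open>P 0\<close> in auto)
  then obtain a b where a: "continuous_on S a"
    and ab: "\<And>x. x \<in> S \<Longrightarrow> line (x, 1) (a x) (b x)"
    and ag: "\<And>x. x \<in> S \<Longrightarrow> a (g x) = \<zeta> * a x"
    unfolding P_def by blast
  have "a x \<noteq> 0" if x: "x \<in> S" for x
  proof
    assume 0: "a x = 0"
    then have "b x \<noteq> 0" and eq: "of_real (r (x, 1)) * b x = - (of_real (s (x, 1)) * b x)"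
      using ab [OF x] by (auto simp: line_def)
    moreover have "complex_of_real (r (x, 1) + s (x, 1)) * b x = 0"
      using eq by (simp add: distrib_right)
    moreover have "r (x, 1) + s (x, 1) > 0" using top [OF x] by (simp add: r_def add_nonneg_pos)
    ultimately show False by (metis mult_eq_0_iff of_real_eq_0_iff less_irrefl)
  qed
  with a ag show thesis using that by blast
qed

section \<open>Orbits in a separating set\<close>

text \<open>This is the topological form of the existence of triple points.  A failure would give, through a
function \<open>F\<close> that separates \<open>0\<close> from infinity, a nowhere vanishing pair \<open>(s, w)\<close> to which the
transport of lines applies, and so an equivariant map from the sphere to the punctured plane.\<close>

lemma separating_set_contains_scaled_orbit:
  fixes K :: "'n::euclidean_space set" and g :: "'n \<Rightarrow> 'n"
  assumes dim: "DIM('n) \<ge> 3"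
    and K: "compact K" "0 \<notin> K" "bounded (connected_component_set (- K) 0)"
    and g: "continuous_on (sphere 0 1) g" "g ` sphere 0 1 \<subseteq> sphere 0 1"
    and g3: "\<And>x. x \<in> sphere 0 1 \<Longrightarrow> g (g (g x)) = x"
  obtains x r where "x \<in> sphere 0 1" "r > 0" "r *\<^sub>R x \<in> K" "r *\<^sub>R g x \<in> K" "r *\<^sub>R g (g x) \<in> K"
proof (rule ccontr)
  let ?S = "sphere (0::'n) 1"
  note * = that
  assume "\<not> thesis"
  then have no: "\<not> (r *\<^sub>R x \<in> K \<and> r *\<^sub>R g x \<in> K \<and> r *\<^sub>R g (g x) \<in> K)" if "x \<in> ?S" "r > 0" for x r
    using \<open>\<not> thesis\<close> that * [of x r] by blast
  obtain F :: "'n \<Rightarrow> real" and R where F: "continuous_on UNIV F" and FK: "\<And>y. F y = 0 \<Longrightarrow> y \<in> K"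
    and F0: "F 0 < 0" and R: "R > 0" and FR: "\<And>y. norm y \<ge> R \<Longrightarrow> F y > 0"
    using separating_function [OF K] by blast
  define \<omega> where "\<omega> = cis (2 * pi / 3)"
  have re: "Re \<omega> = - 1 / 2" and im: "Im \<omega> = sqrt 3 / 2"
    by (simp_all add: \<omega>_def cos_120 sin_120)
  have \<omega>\<omega>: "\<omega> * cnj \<omega> = 1" "\<omega> * \<omega> = cnj \<omega>"
    by (simp_all add: complex_eq_iff re im)
  \<comment> \<open>time is rescaled so that \<open>t = 1\<close> is the sphere of radius \<open>R\<close>, on which \<open>F\<close> is positive\<close>
  define A where "A = (\<lambda>(x, t). F ((R * t) *\<^sub>R x))"
  \<comment> \<open>the invariant component and the \<open>\<omega>\<close>-component of the triple of values under cyclic permutation\<close>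
  define s where "s p = A p + A (g (fst p), snd p) + A (g (g (fst p)), snd p)" for p
  define w where "w p = A p + cnj \<omega> * A (g (fst p), snd p) + \<omega> * A (g (g (fst p)), snd p)" for p
  have gS: "g x \<in> ?S" if "x \<in> ?S" for x
    using g(2) that by blast
  have contA: "continuous_on X (\<lambda>p. A (u p, v p))" if "continuous_on X u" "continuous_on X v"
    for X :: "('n \<times> real) set" and u v
    unfolding A_def prod.case by (intro continuous_on_compose2 [OF F] continuous_intros that) auto
  have cg: "continuous_on (?S \<times> {0..1}) (\<lambda>p. g (fst p))"
    by (rule continuous_on_compose2 [OF g(1)]) (auto intro: continuous_intros)
  have cgg: "continuous_on (?S \<times> {0..1}) (\<lambda>p. g (g (fst p)))"
    by (rule continuous_on_compose2 [OF g(1) cg]) (use gS in auto)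
  have cA: "continuous_on (?S \<times> {0..1}) A"
    using contA [OF continuous_on_fst [OF continuous_on_id] continuous_on_snd [OF continuous_on_id]]
    by simp
  have cs: "continuous_on (?S \<times> {0..1}) s" and cw: "continuous_on (?S \<times> {0..1}) w"
    unfolding s_def w_def by (intro continuous_intros cA contA cg cgg)+
  have nz: "s (x, t) \<noteq> 0 \<or> w (x, t) \<noteq> 0" if x: "x \<in> ?S" and t: "t \<in> {0..1}" for x t
  proof (rule ccontr)
    assume "\<not> ?thesis"
    \<comment> \<open>\<open>w = 0\<close> makes the three real values equal, and then \<open>s = 0\<close> makes them zero\<close>
    then have "A (x, t) = 0" "A (g x, t) = 0" "A (g (g x), t) = 0"
      by (simp_all add: s_def w_def complex_eq_iff re im)
    then have "(R * t) *\<^sub>R x \<in> K" "(R * t) *\<^sub>R g x \<in> K" "(R * t) *\<^sub>R g (g x) \<in> K"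
      by (auto simp: A_def intro: FK)
    moreover have "t > 0"
      using calculation(1) K(2) t by (cases "t = 0") auto
    ultimately show False
      using no [OF x, of "R * t"] R by auto
  qed
  obtain a where a: "continuous_on ?S a" "\<And>x. x \<in> ?S \<Longrightarrow> a x \<noteq> 0" "\<And>x. x \<in> ?S \<Longrightarrow> a (g x) = \<omega> * a x"
  proof (rule equivariant_line_transport [OF compact_sphere cs cw nz])
    fix x :: 'n and t :: real assume x: "x \<in> ?S" and t: "t \<in> {0..1}"
    show "s (g x, t) = s (x, t)"
      using g3 [OF x] by (simp add: s_def)
    have "w (g x, t) = A (g x, t) + cnj \<omega> * A (g (g x), t) + \<omega> * A (x, t)"
      using g3 [OF x] by (simp add: w_def)
    also have "\<dots> = \<omega> * A (x, t) + (\<omega> * cnj \<omega>) * A (g x, t) + (\<omega> * \<omega>) * A (g (g x), t)"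
      by (simp add: \<omega>\<omega>)
    also have "\<dots> = \<omega> * w (x, t)"
      by (simp add: w_def algebra_simps)
    finally show "w (g x, t) = \<omega> * w (x, t)" .
  next
    show "norm \<omega> = 1" by (simp add: \<omega>_def)
  next
    fix x :: 'n assume x: "x \<in> ?S"
    show "s (x, 0) < 0 \<and> w (x, 0) = 0"
      using F0 by (simp add: s_def w_def A_def complex_eq_iff re im)
    show "s (x, 1) > 0"
      using FR gS [OF x] gS [OF gS [OF x]] x R by (auto simp: s_def A_def intro!: add_pos_pos)
  qed auto
  have "?S \<noteq> {}"
    using vector_choose_size [of 1] by (auto simp: dist_norm)
  then show False
    using no_cyclic_equivariant_map_to_punctured_plane [of ?S g 3 a] simply_connected_sphere [OF dim] g g3 a
    by (auto simp: locally_path_connected_sphere numeral_3_eq_3 \<omega>_def)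
qed

section \<open>Triple points of sweepouts\<close>

lemma smooth_on_subset_imp_continuous_on:
  assumes "smooth_on_subset S f" shows "continuous_on S f"
  unfolding continuous_on_eq_continuous_within
proof
  fix x assume x: "x \<in> S"
  then obtain U F where U: "open U" "x \<in> U" "smooth_on U F" and F: "\<forall>y\<in>S \<inter> U. F y = f y"
    using assms unfolding smooth_on_subset_def by blast
  have "continuous_on U F"
    using U(3) unfolding smooth_on_def by (metis Ck_on.simps(1))
  then have "continuous_on (S \<inter> U) f"
    using F by (metis continuous_on_cong continuous_on_subset inf_le2)
  then have "continuous (at x within (S \<inter> U)) f"
    using x U(2) by (simp add: continuous_on_eq_continuous_within)
  then show "continuous (at x within S) f"
    using U(1,2) at_within_nhd [of x U "S \<inter> U" S] by (auto simp: continuous_within)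
qed

theorem lemma4p1:
  fixes g :: "real^4 \<Rightarrow> real^4"
    and M :: "'a topology"
    and A :: "('a, real^3) atlas"
    and f :: "'a \<Rightarrow> real^4"
    and h :: "'a \<Rightarrow> real"
  assumes "diffeomorphism_on S3 g"
    and "\<And>x. x \<in> S3 \<Longrightarrow> g x \<noteq> x"
    and "\<And>x. x \<in> S3 \<Longrightarrow> (g ^^ 3) x = x"
    and "generalised_sweepout M A f h"
  shows "\<exists>t. sweepout_surface M f h t \<inter> g ` sweepout_surface M f h t
            \<inter> (g ^^ 2) ` sweepout_surface M f h t \<noteq> {}"
proof -
  have g: "continuous_on S3 g" "g ` S3 \<subseteq> S3"
    using assms(1) by (auto simp: diffeomorphism_on_def bij_betw_def intro: smooth_on_subset_imp_continuous_on)
  have g3: "g (g (g x)) = x" if "x \<in> S3" for x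
    using assms(3) [OF that] by (simp add: numeral_3_eq_3)
  have M: "compact_space M"
    using assms(4) by (simp add: generalised_sweepout_def closed_manifold_def)
  have "embedding_map M (top_of_set (S3 \<times> UNIV)) (\<lambda>p. (f p, h p))"
    using assms(4) by (simp add: generalised_sweepout_def smooth_embedding_def)
  then have "continuous_map M (prod_topology (top_of_set S3) euclidean) (\<lambda>p. (f p, h p))"
    using homeomorphic_imp_continuous_map
      prod_topology_subtopology_eu [of S3 "UNIV :: real set"]
    by (fastforce simp: embedding_map_def continuous_map_in_subtopology)
  then have f: "continuous_map M (top_of_set S3) f" and h: "continuous_map M euclideanreal h"
    by (auto simp: continuous_map_pairwise o_def)
  have f1: "norm (f p) = 1" if "p \<in> topspace M" for p
    using f that by (auto simp: continuous_map_in_subtopology)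
  obtain \<omega> \<eta> where or: "orientation 3 (top_of_set S3) \<eta>"
    and deg: "has_degree 3 M \<omega> (top_of_set S3) \<eta> f 1"
    using assms(4) by (auto simp: generalised_sweepout_def)
  have ess: "\<not> homotopic_with (\<lambda>_. True) M (top_of_set S3) f (\<lambda>_. c)" for c
    using degree_one_imp_essential [OF _ _ or deg] by simp
  define K where "K = (\<lambda>p. exp (h p) *\<^sub>R f p) ` topspace M"
  have K: "compact K" "0 \<notin> K" "bounded (connected_component_set (- K) 0)"
    unfolding K_def using essential_map_separates_origin [OF M f h ess] by blast+
  obtain x r where x: "x \<in> S3" and r: "r > 0"
    and rK: "r *\<^sub>R x \<in> K" "r *\<^sub>R g x \<in> K" "r *\<^sub>R g (g x) \<in> K"
    using separating_set_contains_scaled_orbit [OF _ K g g3] by auto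
  have in_surface: "y \<in> sweepout_surface M f h (ln r)" if y: "y \<in> S3" "r *\<^sub>R y \<in> K" for y
  proof -
    obtain p where p: "p \<in> topspace M" and eq: "r *\<^sub>R y = exp (h p) *\<^sub>R f p"
      using y(2) by (auto simp: K_def)
    have "r = exp (h p)"
      using arg_cong [OF eq, of norm] y(1) r f1 [OF p] by simp
    then have "h p = ln r" "y = f p"
      using eq by auto
    then show ?thesis
      using p by (auto simp: sweepout_surface_def level_set_def)
  qed
  have "g x \<in> S3" "g (g x) \<in> S3"
    using x g(2) by blast+
  then have "g (g x) \<in> sweepout_surface M f h (ln r) \<inter> g ` sweepout_surface M f h (ln r)
      \<inter> (g ^^ 2) ` sweepout_surface M f h (ln r)"
    using in_surface rK x by (auto simp: numeral_2_eq_2)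
  then show ?thesis by blast
qed

end
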